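(* Let $\theta\in\mathbb{R}$ with $0\le\theta\le 2$, and let $\Delta=ABC$ be the (possibly degenerate) isosceles triangle with $AB=AC=1$ and $BC=\theta$. Then there exists a point $M$ in the plane of $\Delta$ with $M\neq A$ such that $MA$, $MB$, $MC$ are all rational numbers if and only if $$\theta^2=2\left(1+pq\pm\sqrt{(1-p^2)(1-q^2)}\right)$$ for some rational numbers $p,q$ with $-1\le p,q\le 1$ (and some choice of the sign $\pm$).
   Context: For the triangle $(1,\theta,1)$ the apex $A$ is disregarded: the problem asks for points other than the apex at rational distance from all three vertices. The degenerate cases $\theta=0$ (so $B=C$) and $\theta=2$ (so $A$ is the midpoint of $BC$) are included. *)

theory Defs
  imports "HOL-Analysis.Analysis"
begin

end

theory Submission
  imports Defs
begin

text \<open>Write \<open>b = B - A\<close>, \<open>c = C - A\<close>, \<open>k = b \<bullet> c\<close>, so that \<open>\<theta>\<^sup>2 = 2 - 2k\<close>. For \<open>M = A + r u\<close> with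
  \<open>u\<close> a unit vector and \<open>r\<close> rational, \<open>MB\<^sup>2 = r\<^sup>2 - 2r(u \<bullet> b) + 1\<close>, and similarly for \<open>C\<close>; hence if all
  three distances are rational, so are \<open>p = u \<bullet> b\<close> and \<open>q = u \<bullet> c\<close>, and the vanishing of the Gram
  determinant of \<open>u, b, c\<close> in the plane is the equation \<open>(k - pq)\<^sup>2 = (1 - p\<^sup>2)(1 - q\<^sup>2)\<close>.
  Conversely this equation provides the unit vector \<open>u\<close>, and it remains to find a rational \<open>r \<noteq> 0\<close>
  making both \<open>r\<^sup>2 - 2pr + 1\<close> and \<open>r\<^sup>2 - 2qr + 1\<close> squares. If \<open>p + q \<noteq> 0\<close> then
  \<open>r = 4(p + q) / (4 - (p - q)\<^sup>2)\<close> does it. If \<open>p + q = 0\<close> then \<open>\<theta>\<close> is itself rational and \<open>M = B\<close>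
  works. The pair of the theorem is \<open>(p, -q)\<close>.\<close>

lemma inner_real2: "(x :: real ^ 2) \<bullet> y = x $ 1 * y $ 1 + x $ 2 * y $ 2"
  by (simp add: inner_vec_def sum_2)

lemma gram_unit_plane:
  fixes u b c :: "real ^ 2"
  assumes "u \<bullet> u = 1" "b \<bullet> b = 1" "c \<bullet> c = 1"
  shows "(b \<bullet> c - (u \<bullet> b) * (u \<bullet> c))\<^sup>2 = (1 - (u \<bullet> b)\<^sup>2) * (1 - (u \<bullet> c)\<^sup>2)"
  using assms unfolding inner_real2 by algebra

text \<open>In the orthonormal basis formed by \<open>b\<close> and its quarter turn,
  \<open>u\<close> must have coordinates \<open>p\<close> and a square root of
  \<open>1 - p^2\<close>; the sign of the root is chosen to fit \<open>q\<close>.\<close>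

lemma exists_unit_with_inner_products:
  fixes b c :: "real ^ 2" and p q :: real
  assumes "b \<bullet> b = 1" "c \<bullet> c = 1" "\<bar>p\<bar> \<le> 1"
    and "(b \<bullet> c - p * q)\<^sup>2 = (1 - p\<^sup>2) * (1 - q\<^sup>2)"
  obtains u where "u \<bullet> u = 1" "u \<bullet> b = p" "u \<bullet> c = q"
proof -
  \<comment> \<open>\<open>k\<close> and \<open>d\<close> are the coordinates of \<open>c\<close> in
    that basis.\<close>
  define k d where "k = b \<bullet> c" and "d = b $ 1 * c $ 2 - b $ 2 * c $ 1"
  define e where "e = sqrt (1 - p\<^sup>2)"
  have e: "e\<^sup>2 = 1 - p\<^sup>2"
    using assms(3) by (simp add: e_def abs_square_le_1)
  have "d\<^sup>2 + k\<^sup>2 = (b \<bullet> b) * (c \<bullet> c)"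
    unfolding k_def d_def inner_real2 by algebra
  then have "d\<^sup>2 = 1 - k\<^sup>2"
    using assms(1,2) by simp
  \<comment> \<open>The hypothesis expands to
    \<open>1 - p^2 - q^2 - k^2 + 2 * p * q * k = 0\<close>, which is symmetric in \<open>p\<close>,
    \<open>q\<close>, \<open>k\<close>.\<close>
  moreover have "(q - p * k)\<^sup>2 = (1 - p\<^sup>2) * (1 - k\<^sup>2)"
    using assms(4) unfolding k_def [symmetric] by (simp add: power2_eq_square algebra_simps)
  ultimately have "(q - p * k)\<^sup>2 = (e * d)\<^sup>2"
    by (simp add: power_mult_distrib e)
  then consider "q = p * k + e * d" | "q = p * k + - e * d"
    unfolding power2_eq_iff by argo
  then obtain f where f: "f\<^sup>2 = 1 - p\<^sup>2" "q = p * k + f * d"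
  proof cases
    case 1
    with e show thesis by (rule that)
  next
    case 2
    have "(- e)\<^sup>2 = 1 - p\<^sup>2" using e by simp
    then show thesis using 2 by (rule that)
  qed
  define u :: "real ^ 2" where
    "u = vector [p * b $ 1 - f * b $ 2, p * b $ 2 + f * b $ 1]"
  have u: "u $ 1 = p * b $ 1 - f * b $ 2" "u $ 2 = p * b $ 2 + f * b $ 1"
    by (simp_all add: u_def)
  have "u \<bullet> u = (p\<^sup>2 + f\<^sup>2) * (b \<bullet> b)" "u \<bullet> b = p * (b \<bullet> b)" "u \<bullet> c = p * k + f * d"
    unfolding inner_real2 u k_def d_def by (simp_all add: power2_eq_square algebra_simps)
  then have "u \<bullet> u = 1" "u \<bullet> b = p" "u \<bullet> c = q"
    using assms(1) f by simp_all
  then show thesis by (rule that)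
qed

lemma dist_along_ray:
  fixes A B u :: "'a :: real_inner"
  assumes "u \<bullet> u = 1" "dist A B = 1"
  shows "(dist (A + r *\<^sub>R u) B)\<^sup>2 = r\<^sup>2 - 2 * r * (u \<bullet> (B - A)) + 1"
proof -
  have "(B - A) \<bullet> (B - A) = 1"
    using assms(2) by (simp add: dist_norm norm_minus_commute dot_square_norm)
  moreover have "dist (A + r *\<^sub>R u) B = norm (r *\<^sub>R u - (B - A))"
    by (simp add: dist_norm algebra_simps)
  moreover have "(norm (r *\<^sub>R u - v))\<^sup>2 = r\<^sup>2 * (u \<bullet> u) - 2 * r * (u \<bullet> v) + v \<bullet> v" for v
    unfolding power2_norm_eq_inner
    by (simp add: inner_diff_left inner_diff_right inner_commute [of v u] power2_eq_square
        right_diff_distrib)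
  ultimately show ?thesis
    using assms(1) by (metis mult.right_neutral)
qed

lemma unit_inner_rational:
  fixes A B u :: "'a :: real_inner"
  assumes "u \<bullet> u = 1" "dist A B = 1" "r \<noteq> 0" "r \<in> \<rat>" "dist (A + r *\<^sub>R u) B \<in> \<rat>"
  shows "u \<bullet> (B - A) \<in> \<rat>"
proof -
  have "u \<bullet> (B - A) = (r\<^sup>2 + 1 - (dist (A + r *\<^sub>R u) B)\<^sup>2) / (2 * r)"
    using dist_along_ray [OF assms(1,2), of r] assms(3) by (simp add: field_simps)
  then show ?thesis using assms(4,5) by simp
qed

text \<open>The point on \<open>s\<^sup>2 = r\<^sup>2 - 2pr + 1\<close>, \<open>t\<^sup>2 = r\<^sup>2 - 2qr + 1\<close> comes from substituting \<open>s = 1 + mr\<close>,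
  which gives \<open>r = 2(m + p) / (1 - m\<^sup>2)\<close>, and choosing \<open>m\<close> so that the remaining quartic in \<open>m\<close> agrees
  with the square of the polynomial part of its square root; this yields \<open>m = (q - p) / 2\<close>.\<close>

lemma common_rational_squares:
  fixes p q :: real
  assumes "p \<in> \<rat>" "q \<in> \<rat>" "\<bar>p\<bar> \<le> 1" "\<bar>q\<bar> \<le> 1" "p + q \<noteq> 0"
  obtains r s t :: real where "r \<in> \<rat>" "s \<in> \<rat>" "t \<in> \<rat>" "r \<noteq> 0"
    "s\<^sup>2 = r\<^sup>2 - 2 * r * p + 1" "t\<^sup>2 = r\<^sup>2 - 2 * r * q + 1"
proof -
  define D r m where "D = 4 - (p - q)\<^sup>2" and "r = 4 * (p + q) / D" and "m = (q - p) / 2"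
  have "D = (2 - p + q) * (2 + p - q)"
    by (simp add: D_def power2_eq_square algebra_simps)
  \<comment> \<open>A zero factor means \<open>p - q\<close> is 2 or -2, which forces
    \<open>p\<close> and \<open>q\<close> to be 1 and -1 in some order, so
    \<open>p + q = 0\<close>.\<close>
  then have "D \<noteq> 0" using assms(3-5) by auto
  then have r: "r * (4 - (p - q)\<^sup>2) = 4 * (p + q)"
    by (simp add: r_def D_def)
  have rm: "r \<in> \<rat>" "m \<in> \<rat>"
    using assms(1,2) by (simp_all add: r_def m_def D_def)
  have m: "2 * m = q - p" by (simp add: m_def)
  have *: "(1 - m\<^sup>2) * r = p + q"
    using r m by algebra
  show thesis
  proof
    \<comment> \<open>Swapping \<open>p\<close> and \<open>q\<close> fixes \<open>r\<close> and
      negates \<open>m\<close>, so \<open>1 - m * r\<close> serves as \<open>t\<close>.\<close>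
    show "r \<in> \<rat>" "1 + m * r \<in> \<rat>" "1 - m * r \<in> \<rat>"
      using rm by simp_all
    show "r \<noteq> 0" using assms(5) \<open>D \<noteq> 0\<close> by (simp add: r_def)
    show "(1 + m * r)\<^sup>2 = r\<^sup>2 - 2 * r * p + 1" "(1 - m * r)\<^sup>2 = r\<^sup>2 - 2 * r * q + 1"
      using * m by algebra+
  qed
qed

text \<open>Squaring absorbs the choice of sign; the bounds on \<open>p\<close> and \<open>q\<close>
  make the radicand nonnegative.\<close>

lemma plus_minus_sqrt_iff:
  fixes x p q :: real
  assumes "\<bar>p\<bar> \<le> 1" "\<bar>q\<bar> \<le> 1"
  shows "(x = 2 * (1 + p * q + sqrt ((1 - p\<^sup>2) * (1 - q\<^sup>2))) \<or>
      x = 2 * (1 + p * q - sqrt ((1 - p\<^sup>2) * (1 - q\<^sup>2)))) \<longleftrightarrow>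
    (1 - x / 2 + p * q)\<^sup>2 = (1 - p\<^sup>2) * (1 - q\<^sup>2)"
proof -
  define w where "w = sqrt ((1 - p\<^sup>2) * (1 - q\<^sup>2))"
  have "w\<^sup>2 = (1 - p\<^sup>2) * (1 - q\<^sup>2)"
    using assms by (simp add: w_def abs_square_le_1)
  then have "(1 - x / 2 + p * q)\<^sup>2 = (1 - p\<^sup>2) * (1 - q\<^sup>2) \<longleftrightarrow>
      1 - x / 2 + p * q = w \<or> 1 - x / 2 + p * q = - w"
    by (simp flip: power2_eq_iff)
  then show ?thesis by (fold w_def) argo
qed

theorem theorem1p1:
  fixes \<theta> :: real and A B C :: "real ^ 2"
  assumes "0 \<le> \<theta>" and "\<theta> \<le> 2"
    and "dist A B = 1" and "dist A C = 1" and "dist B C = \<theta>"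
  shows "(\<exists>M :: real ^ 2. M \<noteq> A \<and> dist M A \<in> \<rat> \<and> dist M B \<in> \<rat> \<and> dist M C \<in> \<rat>) \<longleftrightarrow>
    (\<exists>p q :: real. p \<in> \<rat> \<and> q \<in> \<rat> \<and> -1 \<le> p \<and> p \<le> 1 \<and> -1 \<le> q \<and> q \<le> 1 \<and>
      (\<theta>\<^sup>2 = 2 * (1 + p * q + sqrt ((1 - p\<^sup>2) * (1 - q\<^sup>2))) \<or>
       \<theta>\<^sup>2 = 2 * (1 + p * q - sqrt ((1 - p\<^sup>2) * (1 - q\<^sup>2)))))"
    (is "?M \<longleftrightarrow> ?R")
proof -
  define b c k where "b = B - A" and "c = C - A" and "k = b \<bullet> c"
  have b: "b \<bullet> b = 1" and c: "c \<bullet> c = 1"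
    using assms(3,4) by (simp_all add: b_def c_def dist_norm norm_minus_commute dot_square_norm)
  have "dist B C = norm (b - c)" by (simp add: b_def c_def dist_norm)
  then have "\<theta>\<^sup>2 = b \<bullet> b - 2 * k + c \<bullet> c"
    using assms(5) by (simp add: power2_norm_eq_inner inner_diff_left inner_diff_right k_def inner_commute)
  then have k: "\<theta>\<^sup>2 = 2 - 2 * k" using b c by simp
  have R: "?R \<longleftrightarrow> (\<exists>p q :: real. p \<in> \<rat> \<and> q \<in> \<rat> \<and> \<bar>p\<bar> \<le> 1 \<and> \<bar>q\<bar> \<le> 1 \<and>
      (k + p * q)\<^sup>2 = (1 - p\<^sup>2) * (1 - q\<^sup>2))"
  proof -
    have "1 - \<theta>\<^sup>2 / 2 + p * q = k + p * q" for p q unfolding k by (simp add: diff_divide_distrib)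
    then have "(\<theta>\<^sup>2 = 2 * (1 + p * q + sqrt ((1 - p\<^sup>2) * (1 - q\<^sup>2))) \<or>
        \<theta>\<^sup>2 = 2 * (1 + p * q - sqrt ((1 - p\<^sup>2) * (1 - q\<^sup>2)))) \<longleftrightarrow>
      (k + p * q)\<^sup>2 = (1 - p\<^sup>2) * (1 - q\<^sup>2)" if "\<bar>p\<bar> \<le> 1" "\<bar>q\<bar> \<le> 1" for p q
      using plus_minus_sqrt_iff [OF that, of "\<theta>\<^sup>2"] by simp
    moreover have "\<bar>x\<bar> \<le> 1 \<longleftrightarrow> -1 \<le> x \<and> x \<le> 1" for x :: real
      by (auto simp: abs_le_iff)
    ultimately show ?thesis
      by (intro iff_exI) blast
  qed
  show ?thesis unfolding R
  proof
    assume ?M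
    then obtain M where M: "M \<noteq> A" "dist M A \<in> \<rat>" "dist M B \<in> \<rat>" "dist M C \<in> \<rat>" by blast
    define r u where "r = dist M A" and "u = (1 / r) *\<^sub>R (M - A)"
    have "r \<noteq> 0" "r \<in> \<rat>" using M by (simp_all add: r_def)
    then have Mu: "M = A + r *\<^sub>R u" by (simp add: u_def)
    have "norm u = 1" using \<open>r \<noteq> 0\<close> by (simp add: u_def r_def dist_norm)
    then have u: "u \<bullet> u = 1" by (simp add: dot_square_norm)
    have "u \<bullet> b \<in> \<rat>" "u \<bullet> c \<in> \<rat>"
      using unit_inner_rational [OF u _ \<open>r \<noteq> 0\<close> \<open>r \<in> \<rat>\<close>] assms(3,4) M(3,4)
      unfolding Mu b_def c_def by blast+
    moreover have "norm b = 1" "norm c = 1"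
      using b c by (simp_all add: norm_eq_1)
    then have "\<bar>u \<bullet> b\<bar> \<le> 1" "\<bar>u \<bullet> c\<bar> \<le> 1"
      using Cauchy_Schwarz_ineq2 [of u b] Cauchy_Schwarz_ineq2 [of u c] \<open>norm u = 1\<close> by simp_all
    moreover have "(k + (u \<bullet> b) * - (u \<bullet> c))\<^sup>2 = (1 - (u \<bullet> b)\<^sup>2) * (1 - (- (u \<bullet> c))\<^sup>2)"
      using gram_unit_plane [OF u b c] by (simp add: k_def)
    ultimately show "\<exists>p q :: real. p \<in> \<rat> \<and> q \<in> \<rat> \<and> \<bar>p\<bar> \<le> 1 \<and> \<bar>q\<bar> \<le> 1 \<and>
        (k + p * q)\<^sup>2 = (1 - p\<^sup>2) * (1 - q\<^sup>2)"
      by (intro exI [of _ "u \<bullet> b"] exI [of _ "- (u \<bullet> c)"]) simp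
  next
    assume "\<exists>p q :: real. p \<in> \<rat> \<and> q \<in> \<rat> \<and> \<bar>p\<bar> \<le> 1 \<and> \<bar>q\<bar> \<le> 1 \<and>
        (k + p * q)\<^sup>2 = (1 - p\<^sup>2) * (1 - q\<^sup>2)"
    then obtain p q' :: real where pq': "p \<in> \<rat>" "q' \<in> \<rat>" "\<bar>p\<bar> \<le> 1" "\<bar>q'\<bar> \<le> 1"
      "(k + p * q')\<^sup>2 = (1 - p\<^sup>2) * (1 - q'\<^sup>2)" by blast
    define q where "q = - q'"
    have pq: "p \<in> \<rat>" "q \<in> \<rat>" "\<bar>p\<bar> \<le> 1" "\<bar>q\<bar> \<le> 1" "(k - p * q)\<^sup>2 = (1 - p\<^sup>2) * (1 - q\<^sup>2)"
      using pq' by (simp_all add: q_def)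
    show ?M
    proof (cases "p + q = 0")
      case True
      then have "q = - p" by simp
      then have "(k + p\<^sup>2)\<^sup>2 = (1 - p\<^sup>2)\<^sup>2"
        using pq(5) by (simp add: power2_eq_square)
      \<comment> \<open>The first value gives \<open>\<theta> = 2 * \<bar>p\<bar>\<close>, the
        second the flat triangle with \<open>\<theta> = 2\<close>.\<close>
      then have "k = 1 - 2 * p\<^sup>2 \<or> k = - 1"
        unfolding power2_eq_iff by argo
      then have "\<theta>\<^sup>2 = (2 * p)\<^sup>2 \<or> \<theta>\<^sup>2 = 2\<^sup>2"
        using k by (auto simp: power_mult_distrib)
      then have "\<theta> \<in> \<rat>"
        using pq(1) unfolding power2_eq_iff by auto
      then show ?M
        using assms(3,5) by (intro exI [of _ B]) (auto simp: dist_commute)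
    next
      case False
      obtain r s t where rst: "r \<in> \<rat>" "s \<in> \<rat>" "t \<in> \<rat>" "r \<noteq> 0"
        "s\<^sup>2 = r\<^sup>2 - 2 * r * p + 1" "t\<^sup>2 = r\<^sup>2 - 2 * r * q + 1"
        using common_rational_squares [OF pq(1-4) False] .
      obtain u where u: "u \<bullet> u = 1" "u \<bullet> b = p" "u \<bullet> c = q"
        using exists_unit_with_inner_products [OF b c pq(3)] pq(5) unfolding k_def by blast
      define M where "M = A + r *\<^sub>R u"
      have "norm u = 1" using u(1) by (simp add: norm_eq_1)
      then have "u \<noteq> 0" "dist M A = \<bar>r\<bar>" by (auto simp: M_def dist_norm)
      moreover have "(dist M B)\<^sup>2 = s\<^sup>2" "(dist M C)\<^sup>2 = t\<^sup>2"
        using dist_along_ray [OF u(1) assms(3)] dist_along_ray [OF u(1) assms(4)] u(2,3) rst(5,6)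
        by (simp_all add: M_def b_def c_def)
      then have "dist M B \<in> \<rat>" "dist M C \<in> \<rat>"
        using rst(2,3) by (auto simp: power2_eq_iff)
      ultimately show ?M
        using rst(1,4) by (intro exI [of _ M]) (simp add: M_def)
    qed
  qed
qed

end
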